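(* Let $n \geq 3$, $q \geq 1$, $f \geq 0$ and $d \geq 1$ be integers satisfying $f + d = n + 2 - q$. Then there exists a finite simple non-complete connected graph $G$ on the vertex set $[n] = \{1, \ldots, n\}$ with $q = \kappa(G)$, $f = f(G)$ and $d = \operatorname{diam}(G)$ if and only if one has either $$n \geq 3, \quad q = 1, \quad f \geq 2, \quad d \geq 2$$ or $$n \geq 4, \quad q \geq 2, \quad f \geq 2, \quad d = 2.$$
   Context: For a finite simple connected graph $G$ on $[n]$ with edge set $E(G)$: $\operatorname{diam}(G)$ is the diameter, i.e. the maximum over pairs of vertices of the length of a shortest path between them. For non-complete $G$, $\kappa(G)$ is the vertex connectivity, i.e. the smallest cardinality of a set $T \subset [n]$ such that the induced subgraph of $G$ on $[n]\setminus T$ is disconnected. A vertex $i$ is free if $\{i,j\}\in E(G)$ and $\{i,j'\}\in E(G)$ with $j\neq j'$ imply $\{j,j'\}\in E(G)$ (i.e. any two distinct neighbors of $i$ are adjacent). $f(G)$ is the number of free vertices of $G$. *)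

theory Defs
  imports "Graph_Theory.Graph_Theory"
begin

text \<open>
  A finite simple graph is a graph in the sense of \<^locale>\<open>pair_graph\<close>: a finite vertex set with a
  symmetric irreflexive arc relation, so that an edge \<open>{u, v}\<close> is the pair of arcs \<open>(u, v)\<close>, \<open>(v, u)\<close>.
  Distance and diameter are only meaningful for finite, nonempty, connected graphs.
\<close>

definition distance :: "('a, 'b) pre_digraph \<Rightarrow> 'a \<Rightarrow> 'a \<Rightarrow> nat" where
  "distance G u v = (LEAST k. \<exists>p. pre_digraph.apath G u p v \<and> length p = k)"

definition diameter :: "('a, 'b) pre_digraph \<Rightarrow> nat" where
  "diameter G = Max {distance G u v | u v. u \<in> verts G \<and> v \<in> verts G}"

text \<open>
  The null graph is not \<^const>\<open>Digraph_Component.connected\<close>, so \<open>T\<close> is required to be a proper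
  subset of the vertices: deleting every vertex does not count as disconnecting the graph.
  For complete graphs no such \<open>T\<close> exists and the value is unspecified.
\<close>

definition vertex_connectivity :: "('a, 'b) pre_digraph \<Rightarrow> nat" where
  "vertex_connectivity G =
    (LEAST k. \<exists>T. T \<subset> verts G \<and> card T = k \<and>
      \<not> Digraph_Component.connected (G \<restriction> (verts G - T)))"

definition free_vertex :: "('a, 'b) pre_digraph \<Rightarrow> 'a \<Rightarrow> bool" where
  "free_vertex G i \<longleftrightarrow> i \<in> verts G \<and>
    (\<forall>j j'. i \<rightarrow>\<^bsub>G\<^esub> j \<and> i \<rightarrow>\<^bsub>G\<^esub> j' \<and> j \<noteq> j' \<longrightarrow> j \<rightarrow>\<^bsub>G\<^esub> j')"

definition num_free_vertices :: "('a, 'b) pre_digraph \<Rightarrow> nat" where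
  "num_free_vertices G = card {i. free_vertex G i}"

end

theory Submission
  imports Defs
begin

text \<open>
  Let \<open>u\<close> and \<open>v\<close> be at distance \<open>d = diam(G)\<close>. For \<open>0 < i < d\<close> the non-free vertices at distance \<open>i\<close>
  from \<open>u\<close> already separate \<open>u\<close> from \<open>v\<close>, so there are at least \<open>q = \<kappa>(G)\<close> of them. Summing over \<open>i\<close>
  gives \<open>q (d - 1) + f \<le> n\<close> and \<open>q (d - 1) + 2 \<le> n\<close>. Together with \<open>f + d = n + 2 - q\<close> the first bound
  says \<open>(q - 1) (d - 2) \<le> 0\<close>, and the second one \<open>f \<ge> 2\<close>.

  Conversely, in both cases \<open>n = f + q (d - 1)\<close>. Arrange the vertices in layers \<open>0, \<dots>, d\<close> of sizes
  \<open>f - 1, q, \<dots>, q, 1\<close>, join consecutive layers completely and turn the layers strictly between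
  \<open>0\<close> and \<open>d\<close> into cliques. The free vertices are those of the two outer layers, and a set of
  vertices can only separate the graph by containing a whole inner layer.
\<close>

subsection \<open>Distance and connectivity\<close>

context wf_digraph
begin

text \<open>\<open>awalk_to_apath\<close> only cuts cycles out of a walk. \<open>distance\<close>
  minimises over paths, so this is what makes every walk an upper bound for it.\<close>

lemma length_awalk_to_apath_le:
  assumes "awalk u p v"
  shows "length (awalk_to_apath p) \<le> length p"
  using assms
proof (induct rule: awalk_to_apath_induct)
  case (path p)
  then show ?case by (auto simp: awalk_to_apath.simps)
next
  case (decomp p q r s)
  have "p = q @ r @ s"
    using awalk_cyc_decomp_has_prop[OF decomp(1,3)] decomp(2) by simp
  then show ?case
    using decomp step_awalk_to_apath[OF decomp(1,2,3)] by simp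
qed

text \<open>Replaces lists of arcs by powers of the adjacency relation, in which all later distance
  arguments are carried out.\<close>

lemma awalk_iff_relpow:
  assumes "u \<in> verts G"
  shows "(\<exists>p. awalk u p v \<and> length p = k) \<longleftrightarrow> (u, v) \<in> arcs_ends G ^^ k"
  using assms
proof (induction k arbitrary: u)
  case 0
  then show ?case by (auto simp: awalk_Nil_iff)
next
  case (Suc k)
  have "(\<exists>p. awalk u p v \<and> length p = Suc k) \<longleftrightarrow>
    (\<exists>e \<in> arcs G. tail G e = u \<and> (\<exists>p. awalk (head G e) p v \<and> length p = k))"
    (is "?L \<longleftrightarrow> ?R")
  proof
    show "?L \<Longrightarrow> ?R" by (fastforce simp: length_Suc_conv awalk_Cons_iff)
  next
    assume ?R
    then obtain e p where "e \<in> arcs G" "tail G e = u" "awalk (head G e) p v" "length p = k"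
      by blast
    then have "awalk u (e # p) v \<and> length (e # p) = Suc k"
      by (simp add: awalk_Cons_iff)
    then show ?L by blast
  qed
  also have "\<dots> \<longleftrightarrow> (\<exists>e \<in> arcs G. tail G e = u \<and> (head G e, v) \<in> arcs_ends G ^^ k)"
    using Suc.IH by (metis head_in_verts)
  also have "\<dots> \<longleftrightarrow> (u, v) \<in> arcs_ends G O arcs_ends G ^^ k"
    by (auto simp: arcs_ends_conv relcomp_unfold)
  also have "arcs_ends G O arcs_ends G ^^ k = arcs_ends G ^^ Suc k"
    by (simp add: relpow_commute)
  finally show ?case .
qed

text \<open>Together the two facts make \<open>distance\<close> the least exponent that relates
  \<open>u\<close> to \<open>v\<close>. The first reads off a shortest path; the second shortens a
  walk of length \<open>k\<close> to a path.\<close>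

lemma
  assumes "u \<in> verts G" "u \<rightarrow>\<^sup>* v"
  shows distance_in_relpow: "(u, v) \<in> arcs_ends G ^^ distance G u v"
    and distance_le: "\<And>k. (u, v) \<in> arcs_ends G ^^ k \<Longrightarrow> distance G u v \<le> k"
proof -
  obtain p where "apath u p v"
    using assms(2) reachable_apath by blast
  then have "\<exists>k p. apath u p v \<and> length p = k" by blast
  from LeastI_ex[OF this] have "\<exists>p. apath u p v \<and> length p = distance G u v"
    unfolding distance_def .
  then show "(u, v) \<in> arcs_ends G ^^ distance G u v"
    using awalk_iff_relpow[OF assms(1)] by (auto simp: apath_def)
next
  fix k assume "(u, v) \<in> arcs_ends G ^^ k"
  then obtain p where p: "awalk u p v" "length p = k"
    using awalk_iff_relpow[OF assms(1)] by blast
  have "distance G u v \<le> length (awalk_to_apath p)"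
    unfolding distance_def using apath_awalk_to_apath[OF p(1)] by (intro Least_le) blast
  with length_awalk_to_apath_le[OF p(1)] p(2) show "distance G u v \<le> k" by simp
qed

lemma distance_self: "u \<in> verts G \<Longrightarrow> distance G u u = 0"
  using distance_le[of u u 0] by simp

lemma distance_eq_0D:
  "u \<in> verts G \<Longrightarrow> u \<rightarrow>\<^sup>* v \<Longrightarrow> distance G u v = 0 \<Longrightarrow> u = v"
  using distance_in_relpow[of u v] by simp

lemma distance_arc_le:
  assumes "u \<in> verts G" "u \<rightarrow>\<^sup>* v" "v \<rightarrow>\<^bsub>G\<^esub> w"
  shows "distance G u w \<le> Suc (distance G u v)"
  using assms distance_in_relpow[of u v]
  by (intro distance_le) (auto intro: reachable_adj_trans)

text \<open>\<open>v\<close> is the last vertex but one of a shortest walk from \<open>u\<close> to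
  \<open>w\<close>.\<close>

lemma distance_SucE:
  assumes "u \<in> verts G" "u \<rightarrow>\<^sup>* w" "distance G u w = Suc k"
  obtains v where "u \<rightarrow>\<^sup>* v" "v \<rightarrow>\<^bsub>G\<^esub> w" "distance G u v \<le> k"
proof -
  from distance_in_relpow[OF assms(1,2)] assms(3)
  obtain v where v: "(u, v) \<in> arcs_ends G ^^ k" "v \<rightarrow>\<^bsub>G\<^esub> w" by auto
  have "u \<rightarrow>\<^sup>* v"
    using relpow_imp_rtrancl[OF v(1)] assms(1) by (simp add: reachable_conv')
  then show thesis
    using that v distance_le[OF assms(1) _ v(1)] by blast
qed

end

lemma (in fin_digraph) finite_distances:
  "finite {distance G u v | u v. u \<in> verts G \<and> v \<in> verts G}"
  using finite_image_set2[of "\<lambda>u. u \<in> verts G" "\<lambda>v. v \<in> verts G" "distance G"] by simp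

lemma (in fin_digraph) distance_le_diameter:
  "u \<in> verts G \<Longrightarrow> v \<in> verts G \<Longrightarrow> distance G u v \<le> diameter G"
  unfolding diameter_def using finite_distances by (intro Max_ge) auto

lemma (in fin_digraph) diameter_attained:
  assumes "verts G \<noteq> {}"
  obtains u v where "u \<in> verts G" "v \<in> verts G" "distance G u v = diameter G"
proof -
  have "diameter G \<in> {distance G u v | u v. u \<in> verts G \<and> v \<in> verts G}"
    unfolding diameter_def using finite_distances assms by (intro Max_in) auto
  then show thesis using that by force
qed

section \<open>Separation by distance layers\<close>

context sym_digraph
begin

text \<open>\<open>connected\<close> is strong connectivity of the symmetric closure, and closing a
  symmetric arc relation leaves reachability unchanged.\<close>

lemma connected_iff_reachable:
  "connected G \<longleftrightarrow> verts G \<noteq> {} \<and> (\<forall>u\<in>verts G. \<forall>v\<in>verts G. u \<rightarrow>\<^sup>* v)"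
  unfolding connected_def strongly_connected_def
  using reachable_mk_symmetric_eq[OF sym_arcs] by simp

lemma sym_digraph_induce_subgraph:
  "S \<subseteq> verts G \<Longrightarrow> sym_digraph (G \<restriction> S)"
  by (rule induced_graph_imp_graph) auto

text \<open>
  The neighbours of a free vertex at distance \<open>i\<close> from \<open>u\<close> include one at distance \<open>i - 1\<close>, and
  they are pairwise adjacent, so none of them is at distance \<open>i + 1\<close>. Free vertices are therefore
  useless for crossing a distance layer.
\<close>

lemma vertex_connectivity_le_nonfree_layer:
  assumes "connected G" "u \<in> verts G" "v \<in> verts G" "0 < i" "i < distance G u v"
  shows "vertex_connectivity G \<le> card {w \<in> verts G. \<not> free_vertex G w \<and> distance G u w = i}"
    (is "_ \<le> card ?S")
proof -
  have reach: "u \<rightarrow>\<^sup>* w" if "w \<in> verts G" for w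
    using assms(1,2) that by (simp add: connected_iff_reachable)
  interpret H: sym_digraph "G \<restriction> (verts G - ?S)"
    by (rule sym_digraph_induce_subgraph) auto
  \<comment> \<open>Invariant of walks from \<open>u\<close> that avoid \<open>?S\<close>: they
    never pass layer \<open>i\<close>. The critical step leaves a vertex \<open>x\<close> of layer
    \<open>i\<close>, which is free because it survived the deletion.\<close>
  have "distance G u w \<le> i" if "u \<rightarrow>\<^sup>*\<^bsub>G \<restriction> (verts G - ?S)\<^esub> w" for w
    using that
  proof (induction rule: H.reachable_induct)
    case base
    then show ?case using distance_self assms(2) by simp
  next
    case (step x y)
    have xy: "x \<rightarrow>\<^bsub>G\<^esub> y" using step(2) by (rule dominates_induce_subgraphD)
    then have V: "x \<in> verts G" "y \<in> verts G" by (auto dest: adj_in_verts)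
    show ?case
    proof (cases "distance G u x = i")
      case False
      with step.IH distance_arc_le[OF assms(2) reach[OF V(1)] xy] show ?thesis by simp
    next
      case True
      have "x \<in> verts G - ?S"
        using step(2) H.adj_in_verts(1) by fastforce
      with True have "free_vertex G x" by auto
      obtain k where k: "i = Suc k" using assms(4) gr0_implies_Suc by blast
      obtain z where z: "u \<rightarrow>\<^sup>* z" "z \<rightarrow>\<^bsub>G\<^esub> x" "distance G u z \<le> k"
        using distance_SucE[OF assms(2) reach[OF V(1)]] True k by blast
      have "x \<rightarrow>\<^bsub>G\<^esub> z" using z(2) sym_arcs by (simp add: arcs_ends_symmetric)
      then have "z = y \<or> z \<rightarrow>\<^bsub>G\<^esub> y"
        using \<open>free_vertex G x\<close> xy unfolding free_vertex_def by blast
      then show ?thesis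
      proof
        assume "z = y"
        then show ?thesis using z(3) k by simp
      next
        assume "z \<rightarrow>\<^bsub>G\<^esub> y"
        from distance_arc_le[OF assms(2) z(1) this] show ?thesis using z(3) k by simp
      qed
    qed
  qed
  \<comment> \<open>Both ends survive the deletion: \<open>u\<close> is at distance 0 <
    \<open>i\<close>, and \<open>v\<close> lies beyond layer \<open>i\<close>.\<close>
  moreover have "u \<in> verts G - ?S" "v \<in> verts G - ?S"
    using assms distance_self by auto
  ultimately have "\<not> connected (G \<restriction> (verts G - ?S))"
    using assms(5) unfolding H.connected_iff_reachable induce_subgraph_verts
    by (meson leD)
  moreover have "?S \<subset> verts G" using \<open>u \<in> verts G - ?S\<close> by blast
  ultimately show ?thesis
    unfolding vertex_connectivity_def by (intro Least_le) blast
qed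

end

section \<open>Lower bounds for the number of vertices\<close>

context graph
begin

text \<open>Distinct vertices have nonzero distance, so a diameter of at most 1 makes them adjacent.
  This excludes \<open>d = 1\<close> for non-complete graphs.\<close>

lemma complete_digraph_if_diameter_le_1:
  assumes "connected G" "diameter G \<le> 1"
  shows "complete_digraph (card (verts G)) G"
proof -
  have "u \<rightarrow>\<^bsub>G\<^esub> v" if "u \<in> verts G" "v \<in> verts G" "u \<noteq> v" for u v
  proof -
    have reach: "u \<rightarrow>\<^sup>* v" using assms(1) that by (simp add: connected_iff_reachable)
    have "distance G u v \<le> 1" using distance_le_diameter[OF that(1,2)] assms(2) by simp
    moreover have "distance G u v \<noteq> 0" using distance_eq_0D[OF that(1) reach] that(3) by blast
    ultimately have "distance G u v = 1" by simp
    then show ?thesis using distance_in_relpow[OF that(1) reach] by simp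
  qed
  moreover have "u \<in> verts G \<and> v \<in> verts G \<and> u \<noteq> v" if "u \<rightarrow>\<^bsub>G\<^esub> v" for u v
    using that adj_in_verts adj_not_same by blast
  ultimately have "arcs_ends G = {(u, v). (u, v) \<in> verts G \<times> verts G \<and> u \<noteq> v}" by blast
  moreover have "graph G" by unfold_locales
  ultimately show ?thesis unfolding complete_digraph_def by simp
qed

lemma vertex_connectivity_mult_diameter_le:
  assumes "connected G" "0 < diameter G"
  shows "vertex_connectivity G * (diameter G - 1) + num_free_vertices G \<le> card (verts G)"
    and "vertex_connectivity G * (diameter G - 1) + 2 \<le> card (verts G)"
proof -
  obtain u v where uv: "u \<in> verts G" "v \<in> verts G" "distance G u v = diameter G"
    using diameter_attained assms(1) by (metis connected_iff_reachable)
  define S where "S i = {w \<in> verts G. \<not> free_vertex G w \<and> distance G u w = i}" for i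
  have "vertex_connectivity G * (diameter G - 1) = (\<Sum>i\<in>{1..<diameter G}. vertex_connectivity G)"
    by simp
  also have "\<dots> \<le> (\<Sum>i\<in>{1..<diameter G}. card (S i))"
    unfolding S_def using vertex_connectivity_le_nonfree_layer[OF assms(1) uv(1,2)] uv(3)
    by (intro sum_mono) auto
  also have "\<dots> = card (\<Union>i\<in>{1..<diameter G}. S i)"
    by (rule card_UN_disjoint[symmetric]) (auto simp: S_def)
  finally have le: "vertex_connectivity G * (diameter G - 1) \<le> card (\<Union>i\<in>{1..<diameter G}. S i)"
    (is "_ \<le> card ?U") .
  \<comment> \<open>Both claims are instances: \<open>A\<close> is first the set of free vertices,
    then the pair of ends \<open>{u, v}\<close>, which lie in layers 0 and
    \<open>diameter G\<close>.\<close>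
  have bound: "vertex_connectivity G * (diameter G - 1) + card A \<le> card (verts G)"
    if "A \<subseteq> verts G" "A \<inter> ?U = {}" for A
  proof -
    have U: "?U \<subseteq> verts G" by (auto simp: S_def)
    have "card ?U + card A = card (?U \<union> A)"
      using that U finite_verts by (intro card_Un_disjoint[symmetric]) (auto dest: finite_subset)
    also have "\<dots> \<le> card (verts G)" using U that(1) finite_verts by (intro card_mono) auto
    finally show ?thesis using le by linarith
  qed
  show "vertex_connectivity G * (diameter G - 1) + num_free_vertices G \<le> card (verts G)"
    unfolding num_free_vertices_def
  proof (rule bound)
    show "{i. free_vertex G i} \<subseteq> verts G" unfolding free_vertex_def by blast
    show "{i. free_vertex G i} \<inter> ?U = {}" unfolding S_def by blast
  qed
  have u0: "distance G u u = 0" using uv(1) by (rule distance_self)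
  then have "u \<noteq> v" using assms(2) uv(3) by fastforce
  have "u \<notin> ?U" "v \<notin> ?U" using u0 uv(3) unfolding S_def by simp_all
  then have "vertex_connectivity G * (diameter G - 1) + card {u, v} \<le> card (verts G)"
    using uv(1,2) by (intro bound) blast+
  then show "vertex_connectivity G * (diameter G - 1) + 2 \<le> card (verts G)"
    using \<open>u \<noteq> v\<close> by simp
qed

end

subsection \<open>Layered graphs\<close>

text \<open>\<open>image_l\<close> encodes two things at once: no layer number exceeds
  \<open>d\<close>, and none of the layers 0 to \<open>d\<close> is empty. Layer sizes stay open,
  since only the connectivity and the number of free vertices depend on them.\<close>

locale layering =
  fixes V :: "'a set" and l :: "'a \<Rightarrow> nat" and d :: nat
  assumes finite_V: "finite V" and two_le_d: "2 \<le> d" and image_l: "l ` V = {..d}"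
begin

definition layered_graph :: "'a pair_pre_digraph" where
  "layered_graph = \<lparr>pverts = V, parcs = {(x, y). x \<in> V \<and> y \<in> V \<and> x \<noteq> y \<and>
    (l x = Suc (l y) \<or> l y = Suc (l x) \<or> l x = l y \<and> 0 < l x \<and> l x < d)}\<rparr>"

lemma pverts_layered_graph [simp]: "pverts layered_graph = V"
  by (simp add: layered_graph_def)

lemma parcs_layered_graph:
  "(x, y) \<in> parcs layered_graph \<longleftrightarrow> x \<in> V \<and> y \<in> V \<and> x \<noteq> y \<and>
    (l x = Suc (l y) \<or> l y = Suc (l x) \<or> l x = l y \<and> 0 < l x \<and> l x < d)"
  by (simp add: layered_graph_def)

lemma pair_graph_layered_graph: "pair_graph layered_graph"
proof -
  have "parcs layered_graph \<subseteq> V \<times> V" by (auto simp: parcs_layered_graph)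
  then have "finite (parcs layered_graph)" using finite_V finite_subset by blast
  then show ?thesis
    using finite_V
    by unfold_locales (auto simp: parcs_layered_graph symmetric_def intro!: symI)
qed

sublocale L: pair_graph layered_graph
  by (rule pair_graph_layered_graph)

lemma l_le: "x \<in> V \<Longrightarrow> l x \<le> d"
  using image_l by blast

lemma ex_layer: "i \<le> d \<Longrightarrow> \<exists>x\<in>V. l x = i"
  using image_l by (metis atMost_iff imageE)

text \<open>One hypothesis for two uses: \<open>W = V\<close> for the diameter, and
  \<open>W = V - T\<close> for a deleted set \<open>T\<close> that contains no whole inner
  layer.\<close>

definition meets_interior :: "'a set \<Rightarrow> bool" where
  "meets_interior W \<longleftrightarrow> W \<subseteq> V \<and> (\<forall>i. 0 < i \<and> i < d \<longrightarrow> (\<exists>w\<in>W. l w = i))"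

lemma meets_interior_V: "meets_interior V"
  unfolding meets_interior_def using ex_layer by (meson less_imp_le order_refl)

text \<open>Climb one layer at a time. The layers passed strictly between those of \<open>x\<close>
  and \<open>y\<close> are inner ones, so \<open>W\<close> offers a vertex in each.\<close>

lemma relpow_ascending:
  assumes "meets_interior W" "x \<in> W" "y \<in> W" "l y = l x + Suc k"
  shows "(x, y) \<in> (parcs layered_graph \<inter> W \<times> W) ^^ Suc k"
  using assms(2,4)
proof (induction k arbitrary: x)
  case 0
  then show ?case using assms(1,3) by (auto simp: parcs_layered_graph meets_interior_def)
next
  case (Suc k)
  have "l y \<le> d" using assms(1,3) l_le by (auto simp: meets_interior_def)
  with Suc.prems(2) have "0 < Suc (l x)" "Suc (l x) < d" by simp_all
  then obtain z where z: "z \<in> W" "l z = Suc (l x)"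
    using assms(1) unfolding meets_interior_def by blast
  have "(x, z) \<in> parcs layered_graph \<inter> W \<times> W"
    using z Suc.prems(1) assms(1) by (auto simp: parcs_layered_graph meets_interior_def)
  moreover have "(z, y) \<in> (parcs layered_graph \<inter> W \<times> W) ^^ Suc k"
    using Suc.IH[OF z(1)] z(2) Suc.prems(2) by simp
  ultimately show ?case by (rule relpow_Suc_I2)
qed

text \<open>Inner layers are cliques, so one arc suffices there. Outer layers have no arcs inside,
  and the detour through the adjacent inner layer costs two.\<close>

lemma relpow_same_layer:
  assumes "meets_interior W" "x \<in> W" "y \<in> W" "l x = l y"
  shows "\<exists>k\<le>2. (x, y) \<in> (parcs layered_graph \<inter> W \<times> W) ^^ k"
proof -
  consider "x = y" | "x \<noteq> y" "0 < l x" "l x < d" | "l x = 0" | "l x = d"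
    using l_le assms(1,2) unfolding meets_interior_def by (metis gr0I le_neq_implies_less subsetD)
  then show ?thesis
  proof cases
    case 1
    then show ?thesis by (intro exI[of _ 0]) simp
  next
    case 2
    then have "(x, y) \<in> parcs layered_graph \<inter> W \<times> W"
      using assms by (auto simp: parcs_layered_graph meets_interior_def)
    then show ?thesis by (intro exI[of _ 1]) simp
  next
    case 3
    have "0 < (1::nat)" "1 < d" using two_le_d by simp_all
    then obtain z where z: "z \<in> W" "l z = 1"
      using assms(1) unfolding meets_interior_def by blast
    then have "(x, z) \<in> parcs layered_graph \<inter> W \<times> W" "(z, y) \<in> parcs layered_graph \<inter> W \<times> W"
      using assms 3 by (auto simp: parcs_layered_graph meets_interior_def)
    then have "(x, y) \<in> (parcs layered_graph \<inter> W \<times> W) ^^ 2"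
      by (auto simp: numeral_2_eq_2)
    then show ?thesis by blast
  next
    case 4
    have "0 < d - 1" "d - 1 < d" using two_le_d by simp_all
    then obtain z where "z \<in> W" "l z = d - 1"
      using assms(1) unfolding meets_interior_def by blast
    then have z: "z \<in> W" "Suc (l z) = d" using \<open>0 < d - 1\<close> by simp_all
    have "x \<in> V" "y \<in> V" "z \<in> V" using assms z(1) by (auto simp: meets_interior_def)
    then have "(x, z) \<in> parcs layered_graph \<inter> W \<times> W" "(z, y) \<in> parcs layered_graph \<inter> W \<times> W"
      using assms(2-4) 4 z unfolding Int_iff mem_Sigma_iff parcs_layered_graph by auto
    then have "(x, y) \<in> (parcs layered_graph \<inter> W \<times> W) ^^ 2"
      by (auto simp: numeral_2_eq_2)
    then show ?thesis by blast
  qed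
qed

lemma relpow_sym:
  "(x, y) \<in> (parcs layered_graph \<inter> W \<times> W) ^^ k \<Longrightarrow> (y, x) \<in> (parcs layered_graph \<inter> W \<times> W) ^^ k"
proof (induction k arbitrary: y)
  case (Suc k)
  then obtain z where "(x, z) \<in> (parcs layered_graph \<inter> W \<times> W) ^^ k" "(z, y) \<in> parcs layered_graph \<inter> W \<times> W"
    by auto
  moreover from this(2) have "(y, z) \<in> parcs layered_graph \<inter> W \<times> W"
    by (auto simp: parcs_layered_graph)
  ultimately show ?case using Suc.IH relpow_Suc_I2 by metis
qed simp

text \<open>The existence of \<open>k\<close> gives connectedness of the subgraph induced on
  \<open>W\<close>; the bound \<open>d\<close> gives, for \<open>W = V\<close>, the upper bound on
  the diameter. Two vertices of the same layer fit the bound because 2 \<le>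
  \<open>d\<close>.\<close>

lemma ex_relpow_le:
  assumes "meets_interior W" "x \<in> W" "y \<in> W"
  shows "\<exists>k\<le>d. (x, y) \<in> (parcs layered_graph \<inter> W \<times> W) ^^ k"
proof -
  have le: "l x \<le> d" "l y \<le> d" using assms l_le by (auto simp: meets_interior_def)
  consider "l x = l y" | "l x < l y" | "l y < l x" by linarith
  then show ?thesis
  proof cases
    case 1
    then show ?thesis using relpow_same_layer[OF assms] two_le_d order_trans by blast
  next
    case 2
    then obtain k where k: "l y = l x + Suc k" using less_imp_Suc_add by fastforce
    then show ?thesis
      using relpow_ascending[OF assms k] le by (intro exI[of _ "Suc k"]) simp
  next
    case 3
    then obtain k where k: "l x = l y + Suc k" using less_imp_Suc_add by fastforce
    then show ?thesis
      using relpow_sym[OF relpow_ascending[OF assms(1,3,2) k]] le by (intro exI[of _ "Suc k"]) simp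
  qed
qed

lemma connected_induce_layered_graph:
  assumes "meets_interior W"
  shows "connected (layered_graph \<restriction> W)"
proof -
  have W: "W \<subseteq> V" using assms by (simp add: meets_interior_def)
  interpret H: sym_digraph "layered_graph \<restriction> W"
    using L.sym_digraph_induce_subgraph W by simp
  have ends: "arcs_ends (layered_graph \<restriction> W) = parcs layered_graph \<inter> W \<times> W"
    by (auto simp: arcs_ends_conv image_iff)
  have "0 < (1::nat)" "1 < d" using two_le_d by simp_all
  then have "W \<noteq> {}" using assms unfolding meets_interior_def by blast
  moreover have "x \<rightarrow>\<^sup>*\<^bsub>layered_graph \<restriction> W\<^esub> y" if "x \<in> W" "y \<in> W" for x y
    using ex_relpow_le[OF assms that] relpow_imp_rtrancl that
    unfolding H.reachable_conv ends by auto
  ultimately show ?thesis unfolding H.connected_iff_reachable by simp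
qed

lemma connected_layered_graph: "connected layered_graph"
proof -
  have "layered_graph \<restriction> V = with_proj layered_graph"
    by (auto simp: induce_subgraph_def with_proj_def layered_graph_def)
  then show ?thesis using connected_induce_layered_graph[OF meets_interior_V] by simp
qed

lemma not_complete_digraph_layered_graph: "\<not> complete_digraph n layered_graph"
proof -
  obtain a where a: "a \<in> V" "l a = 0" using ex_layer[OF le0] by (elim bexE)
  obtain b where b: "b \<in> V" "l b = d" using ex_layer[OF order_refl] by (elim bexE)
  then have "a \<noteq> b" "(a, b) \<notin> parcs layered_graph"
    using a b two_le_d by (auto simp: parcs_layered_graph)
  with a(1) b(1) show ?thesis by (auto simp: complete_digraph_def)
qed

text \<open>An arc changes the layer by at most one. Hence going from layer 0 to layer
  \<open>d\<close> takes at least \<open>d\<close> arcs, the lower bound on the diameter.\<close>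

lemma l_relpow_le: "(x, y) \<in> parcs layered_graph ^^ k \<Longrightarrow> l y \<le> l x + k"
proof (induction k arbitrary: y)
  case (Suc k)
  then obtain z where "(x, z) \<in> parcs layered_graph ^^ k" "(z, y) \<in> parcs layered_graph" by auto
  with Suc.IH[of z] show ?case by (auto simp: parcs_layered_graph)
qed simp

lemma diameter_layered_graph: "diameter layered_graph = d"
proof (rule antisym)
  have reach: "x \<rightarrow>\<^sup>*\<^bsub>layered_graph\<^esub> y" if "x \<in> V" "y \<in> V" for x y
    using connected_layered_graph that by (simp add: L.connected_iff_reachable)
  have V: "V \<noteq> {}" using image_l by auto
  obtain x y where xy: "x \<in> V" "y \<in> V" "distance layered_graph x y = diameter layered_graph"
    using L.diameter_attained V by auto
  have "parcs layered_graph \<inter> V \<times> V = parcs layered_graph" by (auto simp: parcs_layered_graph)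
  then obtain k where "k \<le> d" "(x, y) \<in> parcs layered_graph ^^ k"
    using ex_relpow_le[OF meets_interior_V xy(1,2)] by auto
  then show "diameter layered_graph \<le> d"
    using L.distance_le[of x y k] reach xy by fastforce
  obtain a where a: "a \<in> V" "l a = 0" using ex_layer[OF le0] by (elim bexE)
  obtain b where b: "b \<in> V" "l b = d" using ex_layer[OF order_refl] by (elim bexE)
  note ab = a(1) b(1) a(2) b(2)
  have "d \<le> distance layered_graph a b"
    using l_relpow_le[OF L.distance_in_relpow[OF _ reach[OF ab(1,2)]]] ab by simp
  also have "\<dots> \<le> diameter layered_graph" using L.distance_le_diameter ab by simp
  finally show "d \<le> diameter layered_graph" .
qed

text \<open>An inner vertex has neighbours one layer below and one above, and these are not
  adjacent. The neighbours of an outer vertex all lie in a single inner layer, which is a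
  clique.\<close>

lemma free_vertex_layered_graph_iff:
  "free_vertex layered_graph x \<longleftrightarrow> x \<in> V \<and> (l x = 0 \<or> l x = d)"
proof
  assume free: "free_vertex layered_graph x"
  then have x: "x \<in> V" by (simp add: free_vertex_def)
  have "l x = 0 \<or> l x = d"
  proof (rule ccontr)
    assume "\<not> ?thesis"
    with l_le[OF x] have "0 < l x" "l x < d" by simp_all
    obtain y where "y \<in> V" "l y = l x - 1"
      using ex_layer[of "l x - 1"] l_le[OF x] by fastforce
    moreover obtain z where "z \<in> V" "l z = Suc (l x)"
      using ex_layer[of "Suc (l x)"] \<open>l x < d\<close> by auto
    ultimately have "(x, y) \<in> parcs layered_graph" "(x, z) \<in> parcs layered_graph" "y \<noteq> z"
      "(y, z) \<notin> parcs layered_graph"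
      using x \<open>0 < l x\<close> by (auto simp: parcs_layered_graph)
    then show False using free unfolding free_vertex_def with_proj_simps by blast
  qed
  with x show "x \<in> V \<and> (l x = 0 \<or> l x = d)" by simp
next
  assume x: "x \<in> V \<and> (l x = 0 \<or> l x = d)"
  have neighbour: "y \<in> V \<and> l y = (if l x = 0 then 1 else d - 1)"
    if "(x, y) \<in> parcs layered_graph" for y
    using that x two_le_d l_le[of y] unfolding parcs_layered_graph by auto
  have "(y, z) \<in> parcs layered_graph"
    if "(x, y) \<in> parcs layered_graph" "(x, z) \<in> parcs layered_graph" "y \<noteq> z" for y z
    using neighbour[OF that(1)] neighbour[OF that(2)] that(3) two_le_d
    unfolding parcs_layered_graph by (simp split: if_splits)
  with x show "free_vertex layered_graph x"
    unfolding free_vertex_def with_proj_simps pverts_layered_graph by blast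
qed

lemma vertex_connectivity_layered_graph:
  assumes "\<And>i. 0 < i \<Longrightarrow> i < d \<Longrightarrow> card {x \<in> V. l x = i} = q"
  shows "vertex_connectivity layered_graph = q"
  unfolding vertex_connectivity_def
proof (rule Least_equality)
  let ?T = "{x \<in> V. l x = 1}"
  interpret H: sym_digraph "layered_graph \<restriction> (V - ?T)"
    using L.sym_digraph_induce_subgraph by simp
  obtain a where a: "a \<in> V" "l a = 0" using ex_layer[OF le0] by (elim bexE)
  obtain b where b: "b \<in> V" "l b = d" using ex_layer[OF order_refl] by (elim bexE)
  \<comment> \<open>Every arc leaving layer 0 ends in the deleted layer 1, so a walk from
    \<open>a\<close> cannot leave layer 0.\<close>
  have layer_0: "l x = 0" if "a \<rightarrow>\<^sup>*\<^bsub>layered_graph \<restriction> (V - ?T)\<^esub> x" for x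
    using that
  proof (induction rule: H.reachable_induct)
    case (step x y)
    have "(x, y) \<in> parcs layered_graph" using dominates_induce_subgraphD[OF step(2)] by simp
    moreover have "y \<in> V - ?T" using H.adj_in_verts(2)[OF step(2)] by simp
    ultimately show ?case using step.IH by (auto simp: parcs_layered_graph)
  qed (use a in simp)
  have "\<not> a \<rightarrow>\<^sup>*\<^bsub>layered_graph \<restriction> (V - ?T)\<^esub> b"
  proof
    assume "a \<rightarrow>\<^sup>*\<^bsub>layered_graph \<restriction> (V - ?T)\<^esub> b"
    from layer_0[OF this] show False using b(2) two_le_d by simp
  qed
  moreover have "a \<in> V - ?T" "b \<in> V - ?T" using a b two_le_d by simp_all
  ultimately have "\<not> connected (layered_graph \<restriction> (V - ?T))"
    unfolding H.connected_iff_reachable induce_subgraph_verts by blast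
  moreover have "?T \<subset> V" using \<open>a \<in> V - ?T\<close> by blast
  moreover have "card ?T = q" using assms[of 1] two_le_d by simp
  ultimately show "\<exists>T\<subset>verts layered_graph. card T = q \<and>
      \<not> connected (layered_graph \<restriction> (verts layered_graph - T))"
    unfolding with_proj_simps pverts_layered_graph by blast
next
  fix k assume "\<exists>T\<subset>verts layered_graph. card T = k \<and>
      \<not> connected (layered_graph \<restriction> (verts layered_graph - T))"
  then obtain T where T: "T \<subseteq> V" "card T = k" "\<not> connected (layered_graph \<restriction> (V - T))"
    unfolding with_proj_simps pverts_layered_graph by blast
  \<comment> \<open>A separating set must swallow a whole inner layer, hence at least
    \<open>q\<close> vertices.\<close>
  then have "\<not> meets_interior (V - T)" using connected_induce_layered_graph by blast
  then obtain i where i: "0 < i" "i < d" "{x \<in> V. l x = i} \<subseteq> T"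
    unfolding meets_interior_def by blast
  have "finite T" using T(1) finite_V finite_subset by blast
  then show "q \<le> k" using card_mono[OF _ i(3)] assms[OF i(1,2)] T(2) by simp
qed

end

section \<open>A layer function with prescribed layer sizes\<close>

lemma layers_exist:
  fixes f q d n :: nat
  assumes "2 \<le> f" "1 \<le> q" "2 \<le> d" and n_def: "n = f + q * (d - 1)"
  obtains l where "l ` {1..n} = {..d}"
    and "\<And>i. 0 < i \<Longrightarrow> i < d \<Longrightarrow> card {x \<in> {1..n}. l x = i} = q"
    and "card {x \<in> {1..n}. l x = 0 \<or> l x = d} = f"
proof -
  \<comment> \<open>Cut the numbers from \<open>f\<close> on into consecutive blocks of length
    \<open>q\<close>. Counting from 1, layer 0 receives only \<open>f - 1\<close> vertices, and it
    is nonempty because 2 \<le> \<open>f\<close>.\<close>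
  define l where "l x = (if x < f then 0 else Suc ((x - f) div q))" for x
  have layer_0: "l x = 0 \<longleftrightarrow> x < f" for x by (simp add: l_def)
  have layer_Suc: "l x = Suc j \<longleftrightarrow> f + j * q \<le> x \<and> x < f + Suc j * q" for x j
  proof (cases "x < f")
    case False
    have "(x - f) div q = j \<longleftrightarrow> j \<le> (x - f) div q \<and> (x - f) div q < Suc j" by linarith
    also have "\<dots> \<longleftrightarrow> j * q \<le> x - f \<and> x - f < Suc j * q"
      using assms(2) by (simp only: less_eq_div_iff_mult_less_eq div_less_iff_less_mult)
    finally show ?thesis using False by (simp only: l_def if_False nat.inject) linarith
  qed (simp add: l_def)
  have le_n: "f + Suc j * q \<le> n" if "Suc j < d" for j
    using mult_le_mono1[of "Suc j" "d - 1" q] that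
    unfolding n_def mult.commute[of q] by linarith
  \<comment> \<open>The block of layer \<open>d\<close> begins exactly at \<open>n\<close>, so
    \<open>n\<close> alone falls into it; this vertex brings the outer layers to \<open>f\<close>
    vertices in all.\<close>
  have last_n: "f + j * q = n" if "d = Suc j" for j
    unfolding n_def that mult.commute[of q] by simp
  have interior: "card {x \<in> {1..n}. l x = i} = q" if i: "0 < i" "i < d" for i
  proof -
    obtain j where j: "i = Suc j" using i(1) gr0_implies_Suc by blast
    have "{x \<in> {1..n}. l x = i} = {f + j * q..<f + Suc j * q}"
      using le_n[of j] i(2) assms(1) unfolding j layer_Suc by auto
    then show ?thesis by simp
  qed
  obtain j where j: "d = Suc j" using assms(3) by (cases d) auto
  have layer_d: "x \<in> {1..n} \<Longrightarrow> l x = d \<longleftrightarrow> x = n" for x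
    using last_n[OF j] assms(2) unfolding j layer_Suc by auto
  have "f \<le> n" by (simp add: n_def)
  have "{x \<in> {1..n}. l x = 0 \<or> l x = d} = insert n {1..<f}"
    using layer_0 layer_d \<open>f \<le> n\<close> assms(1) by auto
  then have outer: "card {x \<in> {1..n}. l x = 0 \<or> l x = d} = f"
    using \<open>f \<le> n\<close> assms(1) by simp
  have "l ` {1..n} = {..d}"
  proof (intro equalityI subsetI)
    fix i assume "i \<in> l ` {1..n}"
    then obtain x where x: "x \<le> n" "i = l x" by auto
    then have "x - f \<le> q * (d - 1)" by (simp add: n_def)
    then have "(x - f) div q \<le> d - 1"
      using div_le_mono[of "x - f" "q * (d - 1)" q] assms(2) by simp
    then show "i \<in> {..d}" using x(2) assms(3) by (simp add: l_def) linarith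
  next
    fix i assume i: "i \<in> {..d}"
    show "i \<in> l ` {1..n}"
    proof (cases i)
      case 0
      then show ?thesis
        using layer_0[of 1] \<open>f \<le> n\<close> assms(1) by (intro image_eqI[of _ _ 1]) auto
    next
      case (Suc k)
      have "f + k * q \<le> n"
        using mult_le_mono1[of k "d - 1" q] i Suc
        unfolding n_def mult.commute[of q] by auto
      then show ?thesis
        using layer_Suc[of "f + k * q" k] Suc assms(1,2) by (intro image_eqI[of _ _ "f + k * q"]) auto
    qed
  qed
  then show thesis using that interior outer by blast
qed

section \<open>The characterisation of the possible parameters\<close>

theorem theorem1p4:
  fixes n q f d :: nat
  assumes "n \<ge> 3" and "q \<ge> 1" and "f \<ge> 0" and "d \<ge> 1"
    and "int f + int d = int n + 2 - int q"
  shows "(\<exists>G :: nat pair_pre_digraph.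
            pair_graph G \<and> pverts G = {1..n} \<and>
            Digraph_Component.connected (with_proj G) \<and>
            \<not> complete_digraph n (with_proj G) \<and>
            q = vertex_connectivity (with_proj G) \<and>
            f = num_free_vertices (with_proj G) \<and>
            d = diameter (with_proj G))
     \<longleftrightarrow> (n \<ge> 3 \<and> q = 1 \<and> f \<ge> 2 \<and> d \<ge> 2) \<or> (n \<ge> 4 \<and> q \<ge> 2 \<and> f \<ge> 2 \<and> d = 2)"
proof
  assume "\<exists>G :: nat pair_pre_digraph.
            pair_graph G \<and> pverts G = {1..n} \<and>
            Digraph_Component.connected (with_proj G) \<and>
            \<not> complete_digraph n (with_proj G) \<and>
            q = vertex_connectivity (with_proj G) \<and>
            f = num_free_vertices (with_proj G) \<and>
            d = diameter (with_proj G)"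
  then obtain G :: "nat pair_pre_digraph" where G: "pair_graph G" "pverts G = {1..n}"
    "connected G" "\<not> complete_digraph n G"
    and q: "q = vertex_connectivity G" and f: "f = num_free_vertices G" and d: "d = diameter G"
    by blast
  interpret pair_graph G by fact
  have "d \<noteq> 1"
    using complete_digraph_if_diameter_le_1 G d by auto
  \<comment> \<open>The shifted parameters avoid truncated subtraction. The first bound becomes
    \<open>a * b = 0\<close>, that is, \<open>q = 1\<close> or \<open>d = 2\<close>; the second
    becomes \<open>a + b + 3\<close> \<le> \<open>n\<close>, which with
    \<open>n = f + a + b + 1\<close> gives \<open>f\<close> \<ge> 2.\<close>
  define a b where "a = q - 1" and "b = d - 2"
  then have ab: "q = a + 1" "d = b + 2" using \<open>d \<noteq> 1\<close> assms(2,4) by simp_all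
  have "q * (d - 1) + f \<le> n" "q * (d - 1) + 2 \<le> n"
    using vertex_connectivity_mult_diameter_le G q f d assms(4) by auto
  moreover have "q * (d - 1) = a * b + a + b + 1" by (simp add: ab algebra_simps)
  moreover have "n = f + a + b + 1" using assms(5) ab by linarith
  ultimately have "a * b = 0" "a + b + 3 \<le> n" by linarith+
  then show "(n \<ge> 3 \<and> q = 1 \<and> f \<ge> 2 \<and> d \<ge> 2) \<or> (n \<ge> 4 \<and> q \<ge> 2 \<and> f \<ge> 2 \<and> d = 2)"
    using assms(5) ab by auto
next
  assume "(n \<ge> 3 \<and> q = 1 \<and> f \<ge> 2 \<and> d \<ge> 2) \<or> (n \<ge> 4 \<and> q \<ge> 2 \<and> f \<ge> 2 \<and> d = 2)"
  \<comment> \<open>If \<open>q = 1\<close> or \<open>d = 2\<close>, then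
    \<open>q + d - 2 = q * (d - 1)\<close>, so the assumed relation says that the layer sizes
    \<open>f - 1\<close>, \<open>d - 1\<close> times \<open>q\<close>, and 1 add up to
    \<open>n\<close>.\<close>
  then have n: "n = f + q * (d - 1)" and "2 \<le> f" "2 \<le> d" using assms(5) by auto
  obtain l where layers: "l ` {1..n} = {..d}"
    "\<And>i. 0 < i \<Longrightarrow> i < d \<Longrightarrow> card {x \<in> {1..n}. l x = i} = q"
    "card {x \<in> {1..n}. l x = 0 \<or> l x = d} = f"
    using layers_exist[OF \<open>2 \<le> f\<close> assms(2) \<open>2 \<le> d\<close> n] by blast
  interpret layering "{1..n}" l d
    using layers(1) \<open>2 \<le> d\<close> by unfold_locales auto
  show "\<exists>G :: nat pair_pre_digraph.
            pair_graph G \<and> pverts G = {1..n} \<and>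
            Digraph_Component.connected (with_proj G) \<and>
            \<not> complete_digraph n (with_proj G) \<and>
            q = vertex_connectivity (with_proj G) \<and>
            f = num_free_vertices (with_proj G) \<and>
            d = diameter (with_proj G)"
  proof (intro exI conjI)
    show "pair_graph layered_graph" by (rule pair_graph_layered_graph)
    show "pverts layered_graph = {1..n}" by (rule pverts_layered_graph)
    show "connected layered_graph" by (rule connected_layered_graph)
    show "\<not> complete_digraph n layered_graph" by (rule not_complete_digraph_layered_graph)
    show "q = vertex_connectivity layered_graph"
      using layers(2) by (rule vertex_connectivity_layered_graph[symmetric])
    show "f = num_free_vertices layered_graph"
      unfolding num_free_vertices_def free_vertex_layered_graph_iff by (rule layers(3)[symmetric])
    show "d = diameter layered_graph" by (rule diameter_layered_graph[symmetric])
  qed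
qed

end
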